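(* Let $\lambda>\omega_1$ be a cardinal, let $X$ be a subspace of $\big[\tfrac{1}{2},1\big]^\lambda$, and let $$S:= \big\{ (x_i)\in [0,1]^\lambda: \text{ the support } \{i\in \lambda: x_i\neq 0\} \text{ of } (x_i) \text{ is countable}\big\}.$$ Then the subspace $Y:=S\cup X$ of $[0,1]^\lambda$ satisfies the following conditions: (i) $Y$ is a pseudocompact Ascoli space; (ii) if $K$ is a compact subset of $Y$, then $F:=K\cap S$ and $G:=K\cap X$ are compact; (iii) $Y$ is not a $k_{\mathbb{R}}$-space; (iv) $X$ is a closed subspace of $Y$.
   Context: $[0,1]^\lambda$ carries the product topology. A Tychonoff space is pseudocompact if every continuous real-valued function on it is bounded. $C_k(Y)$ denotes the space $C(Y)$ of all continuous real-valued functions on $Y$ with the compact-open topology. A Tychonoff space $Y$ is Ascoli if every compact subset $\mathcal{K}$ of $C_k(Y)$ is evenly continuous, i.e. the map $Y\times\mathcal{K}\ni(y,f)\mapsto f(y)$ is continuous. A function $f:Y\to\mathbb{R}$ is $k$-continuous if its restriction to every compact subset of $Y$ is continuous, and $Y$ is a $k_{\mathbb{R}}$-space if every $k$-continuous function $f:Y\to\mathbb{R}$ is continuous.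
   Formalization: Condition (iii) is stated only for nonempty X: if X is empty, then Y = S is a Σ-product of intervals, which is Fréchet–Urysohn and hence a k_R-space, so (iii) fails. *)

theory Defs
  imports "HOL-Analysis.Analysis"
begin

unbundle cardinal_syntax

definition Tychonoff_space :: "'a topology \<Rightarrow> bool" where
  "Tychonoff_space Y \<longleftrightarrow> completely_regular_space Y \<and> Hausdorff_space Y"

definition pseudocompact_space :: "'a topology \<Rightarrow> bool" where
  "pseudocompact_space Y \<longleftrightarrow> Tychonoff_space Y \<and>
     (\<forall>f. continuous_map Y euclideanreal f \<longrightarrow> bounded (f ` topspace Y))"

text \<open>Functions are taken extensional on the carrier, so that distinct elements of \<open>C_set Y\<close>
  differ at some point of the space.\<close>

definition C_set :: "'a topology \<Rightarrow> ('a \<Rightarrow> real) set" where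
  "C_set Y = {f \<in> extensional (topspace Y). continuous_map Y euclideanreal f}"

definition C_k :: "'a topology \<Rightarrow> ('a \<Rightarrow> real) topology" where
  "C_k Y = topology_generated_by
     {{f \<in> C_set Y. f ` K \<subseteq> U} | K U. compactin Y K \<and> open U}"

lemma topspace_C_k [simp]: "topspace (C_k Y) = C_set Y"
proof
  show "topspace (C_k Y) \<subseteq> C_set Y"
    by (auto simp: C_k_def topology_generated_by_topspace)
  have "C_set Y \<in> {{f \<in> C_set Y. f ` K \<subseteq> U} | K U. compactin Y K \<and> open U}"
    by (rule CollectI, rule exI[of _ "{}"], rule exI[of _ UNIV]) auto
  then show "C_set Y \<subseteq> topspace (C_k Y)"
    unfolding C_k_def topology_generated_by_topspace by blast
qed

definition evenly_continuous :: "'a topology \<Rightarrow> ('a \<Rightarrow> real) set \<Rightarrow> bool" where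
  "evenly_continuous Y \<K> \<longleftrightarrow>
     continuous_map (prod_topology Y (subtopology (C_k Y) \<K>)) euclideanreal (\<lambda>(y, f). f y)"

definition Ascoli_space :: "'a topology \<Rightarrow> bool" where
  "Ascoli_space Y \<longleftrightarrow> Tychonoff_space Y \<and>
     (\<forall>\<K>. compactin (C_k Y) \<K> \<longrightarrow> evenly_continuous Y \<K>)"

definition k_continuous :: "'a topology \<Rightarrow> ('a \<Rightarrow> real) \<Rightarrow> bool" where
  "k_continuous Y f \<longleftrightarrow>
     (\<forall>K. compactin Y K \<longrightarrow> continuous_map (subtopology Y K) euclideanreal f)"

definition k_R_space :: "'a topology \<Rightarrow> bool" where
  "k_R_space Y \<longleftrightarrow> (\<forall>f. k_continuous Y f \<longrightarrow> continuous_map Y euclideanreal f)"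

text \<open>The index set of a cardinal \<open>\<kappa>\<close> is \<open>Field \<kappa>\<close>; the points of a product topology are
  extensional functions on the index set.\<close>

definition unit_cube :: "'i rel \<Rightarrow> ('i \<Rightarrow> real) topology" where
  "unit_cube \<kappa> = product_topology (\<lambda>_. top_of_set {0..1}) (Field \<kappa>)"

definition Sigma_product :: "'i rel \<Rightarrow> ('i \<Rightarrow> real) set" where
  "Sigma_product \<kappa> = {x \<in> Field \<kappa> \<rightarrow>\<^sub>E {0..1}. countable {i \<in> Field \<kappa>. x i \<noteq> 0}}"

end

theory Submission
  imports Defs "HOL-Library.Countable_Set_Type"
begin

text \<open>
  Every countable subset of the dense set \<open>S\<close> lies in a compact subset of \<open>S\<close>. This alone makes
  \<open>Y\<close> pseudocompact and Ascoli: a sequence in a compact \<open>\<K> \<subseteq> C_k Y\<close> that is \<open>\<epsilon>\<close>-separated in the sup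
  norm is already \<open>\<epsilon>\<close>-separated at countably many points of \<open>S\<close>, hence on one compact set, on which
  \<open>\<K>\<close> is totally bounded. So \<open>\<K>\<close> is totally bounded in the sup norm and therefore evenly continuous.

  For (ii), suppose a point of \<open>X\<close> is in the closure of \<open>K \<inter> S\<close>, and let \<open>I\<close> be a set of \<open>\<omega>\<^sub>1\<close>
  coordinates. By compactness there is \<open>z \<in> K\<close> bounded below by \<open>1/4\<close> on \<open>I\<close> and supported on the union of
  \<open>\<omega>\<^sub>1\<close> countable sets; its support is too large for \<open>S\<close> and too small for \<open>X\<close>. Then the indicator
  function of \<open>X\<close> is \<open>k\<close>-continuous, but discontinuous since \<open>S\<close> is dense.
\<close>

section \<open>Uniform approximation in \<open>C_k Y\<close>, first on compact sets, then on all of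
  Y\<close>

text \<open>A subbasic set only confines the image of one compact set to one open set. Uniform
  closeness on C follows by cutting C into finitely many compact pieces on which f is almost
  constant and confining each piece separately.\<close>

lemma C_k_uniform_nbhd:
  assumes C: "compactin Y C" and f: "f \<in> C_set Y" and "e > 0"
  obtains W where "openin (C_k Y) W" "f \<in> W" "\<forall>g\<in>W. \<forall>y\<in>C. \<bar>g y - f y\<bar> < e"
proof -
  have cont: "continuous_map Y euclideanreal f"
    using f by (simp add: C_set_def)
  have "compact (f ` C)"
    using image_compactin[OF C cont] by simp
  then obtain T where T: "finite T" "f ` C \<subseteq> (\<Union>t\<in>T. ball t (e/3))"
    using \<open>e > 0\<close> by (metis compact_eq_totally_bounded divide_pos_pos zero_less_numeral)
  \<comment> \<open>The closed ball keeps each piece compact. Since e/3 < e/2, f itself lies in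
    \<open>B t\<close>, and e/3 + e/2 < e gives the final estimate.\<close>
  define P where "P t = C \<inter> {y \<in> topspace Y. f y \<in> cball t (e/3)}" for t
  have P: "compactin Y (P t)" for t
    unfolding P_def
    by (intro compact_Int_closedin C closedin_continuous_map_preimage[OF cont]) auto
  define B where "B t = {g \<in> C_set Y. g ` P t \<subseteq> ball t (e/2)}" for t
  have B: "openin (C_k Y) (B t)" for t
    unfolding C_k_def B_def using P by (intro topology_generated_by_Basis) blast
  \<comment> \<open>The factor \<open>topspace (C_k Y)\<close> covers empty T, where the
    intersection alone would be the whole type.\<close>
  define W where "W = (\<Inter>t\<in>T. B t) \<inter> topspace (C_k Y)"
  show thesis
  proof
    show "openin (C_k Y) W"
      unfolding W_def by (intro openin_INT T(1) B)
    show "f \<in> W"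
      using f \<open>e > 0\<close> by (auto simp: W_def B_def P_def)
    show "\<forall>g\<in>W. \<forall>y\<in>C. \<bar>g y - f y\<bar> < e"
    proof (intro ballI)
      fix g y
      assume g: "g \<in> W" and y: "y \<in> C"
      obtain t where t: "t \<in> T" "f y \<in> ball t (e/3)"
        using T y by blast
      then have "y \<in> P t"
        using y compactin_subset_topspace[OF C] by (auto simp: P_def)
      then have "g y \<in> ball t (e/2)"
        using g t(1) unfolding W_def B_def by blast
      with t(2) \<open>e > 0\<close> have "\<bar>t - f y\<bar> < e/3" "\<bar>t - g y\<bar> < e/2"
        by (auto simp: dist_real_def)
      with \<open>e > 0\<close> show "\<bar>g y - f y\<bar> < e"
        by linarith
    qed
  qed
qed

text \<open>Finitely many of the neighbourhoods from \<open>C_k_uniform_nbhd\<close> already cover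
  \<K>; their centres form the net.\<close>

lemma compactin_C_k_net_on_compactin:
  assumes K: "compactin (C_k Y) \<K>" and C: "compactin Y C" and "e > 0"
  obtains N where "finite N" "N \<subseteq> \<K>" "\<forall>g\<in>\<K>. \<exists>f\<in>N. \<forall>y\<in>C. \<bar>g y - f y\<bar> < e"
proof -
  have "\<K> \<subseteq> C_set Y"
    using compactin_subset_topspace[OF K] by simp
  have "\<exists>W. openin (C_k Y) W \<and> f \<in> W \<and> (\<forall>g\<in>W. \<forall>y\<in>C. \<bar>g y - f y\<bar> < e)" if "f \<in> \<K>" for f
  proof -
    have "f \<in> C_set Y"
      using that \<open>\<K> \<subseteq> C_set Y\<close> by blast
    then show ?thesis
      by (rule C_k_uniform_nbhd[OF C _ \<open>e > 0\<close>]) blast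
  qed
  then obtain W where W: "\<And>f. f \<in> \<K> \<Longrightarrow> openin (C_k Y) (W f)" "\<And>f. f \<in> \<K> \<Longrightarrow> f \<in> W f"
      "\<And>f g y. \<lbrakk>f \<in> \<K>; g \<in> W f; y \<in> C\<rbrakk> \<Longrightarrow> \<bar>g y - f y\<bar> < e"
    by metis
  obtain \<F> where F: "finite \<F>" "\<F> \<subseteq> W ` \<K>" "\<K> \<subseteq> \<Union>\<F>"
    using compactinD[OF K, of "W ` \<K>"] W(1,2) by blast
  then obtain N where N: "finite N" "N \<subseteq> \<K>" "\<F> = W ` N"
    by (metis finite_subset_image)
  show thesis
  proof
    show "\<forall>g\<in>\<K>. \<exists>f\<in>N. \<forall>y\<in>C. \<bar>g y - f y\<bar> < e"
      using F(3) N W(3) by blast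
  qed (use N in auto)
qed

lemma compactin_C_k_uniform_net:
  assumes D: "Y closure_of D = topspace Y"
    and bdd: "\<forall>A\<subseteq>D. countable A \<longrightarrow> (\<exists>C. compactin Y C \<and> A \<subseteq> C)"
    and K: "compactin (C_k Y) \<K>" and "e > 0"
  obtains (net) N where "finite N" "N \<subseteq> \<K>"
    "\<forall>g\<in>\<K>. \<exists>f\<in>N. \<forall>y\<in>topspace Y. \<bar>g y - f y\<bar> \<le> e"
proof (rule ccontr)
  assume contr: "\<not> thesis"
  have no: "\<exists>g\<in>\<K>. \<forall>f\<in>N. \<exists>y\<in>topspace Y. e < \<bar>g y - f y\<bar>" if "finite N" "N \<subseteq> \<K>" for N
  proof (rule ccontr)
    assume "\<not> ?thesis"
    then have "\<forall>g\<in>\<K>. \<exists>f\<in>N. \<forall>y\<in>topspace Y. \<bar>g y - f y\<bar> \<le> e"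
      by (meson not_le)
    then show False
      using net[OF that] contr by blast
  qed
  \<comment> \<open>Greedy choice: the earlier terms never form a net, so some member of \<K>
    differs from each of them by more than e somewhere.\<close>
  have "\<exists>g. \<forall>n::nat. g n \<in> \<K> \<and> (\<forall>m<n. \<exists>y\<in>topspace Y. e < \<bar>g n y - g m y\<bar>)"
  proof (rule dependent_wellorder_choice)
    fix n :: nat and g :: "nat \<Rightarrow> 'a \<Rightarrow> real"
    assume "\<And>m. m < n \<Longrightarrow> g m \<in> \<K> \<and> (\<forall>k<m. \<exists>y\<in>topspace Y. e < \<bar>g m y - g k y\<bar>)"
    then show "\<exists>r. r \<in> \<K> \<and> (\<forall>m<n. \<exists>y\<in>topspace Y. e < \<bar>r y - g m y\<bar>)"
      using no[of "g ` {..<n}"] by (simp add: image_subset_iff) blast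
  qed auto
  then obtain g where g: "\<And>n::nat. g n \<in> \<K>"
    and sep: "\<And>m n. m < n \<Longrightarrow> \<exists>y\<in>topspace Y. e < \<bar>g n y - g m y\<bar>"
    by metis
  have cont: "continuous_map Y euclideanreal (g n)" for n
    using g compactin_subset_topspace[OF K] by (force simp: C_set_def)
  \<comment> \<open>The inequality is strict, so it holds on an open set, and that set meets the
    dense D.\<close>
  have "\<exists>y\<in>D. e < \<bar>g n y - g m y\<bar>" if "m < n" for m n
  proof -
    have "continuous_map Y euclideanreal (\<lambda>y. \<bar>g n y - g m y\<bar>)"
      by (intro continuous_intros cont)
    then have "openin Y {y \<in> topspace Y. \<bar>g n y - g m y\<bar> \<in> {e<..}}"
      by (rule openin_continuous_map_preimage) auto
    then show ?thesis
      using D sep[OF that] unfolding dense_intersects_open by fastforce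
  qed
  then obtain p where p: "\<And>m n. m < n \<Longrightarrow> p m n \<in> D" "\<And>m n. m < n \<Longrightarrow> e < \<bar>g n (p m n) - g m (p m n)\<bar>"
    by metis
  define A where "A = (\<lambda>(m,n). p m n) ` {(m,n). m < n}"
  have "countable A" "A \<subseteq> D"
    using p by (auto simp: A_def)
  then obtain C where C: "compactin Y C" "A \<subseteq> C"
    using bdd by blast
  \<comment> \<open>Radius e/2 sets up a pigeonhole: two terms approximated by the same element of
    the finite N differ by less than e on C, against their separation at a point of A.\<close>
  obtain N where N: "finite N" "N \<subseteq> \<K>" "\<forall>g\<in>\<K>. \<exists>f\<in>N. \<forall>y\<in>C. \<bar>g y - f y\<bar> < e/2"
    using compactin_C_k_net_on_compactin[OF K C(1)] \<open>e > 0\<close> by (metis half_gt_zero)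
  then have "\<exists>f\<in>N. \<forall>y\<in>C. \<bar>g n y - f y\<bar> < e/2" for n
    using g by blast
  then obtain h where h: "\<And>n. h n \<in> N" "\<And>n y. y \<in> C \<Longrightarrow> \<bar>g n y - h n y\<bar> < e/2"
    by metis
  have "\<not> inj h"
    using h(1) N(1) by (meson finite_imageD finite_subset image_subsetI infinite_UNIV_nat)
  then obtain m n where mn: "m < n" "h m = h n"
    by (metis injI linorder_neqE_nat)
  then have "p m n \<in> C"
    using C(2) by (auto simp: A_def)
  then have "\<bar>g m (p m n) - h n (p m n)\<bar> < e/2" "\<bar>g n (p m n) - h n (p m n)\<bar> < e/2"
    using h(2) mn(2) by metis+
  then show False
    using p(2)[OF mn(1)] by linarith
qed

section \<open>Criteria for Ascoli and pseudocompact spaces\<close>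

text \<open>A finite sup-norm net reduces joint continuity at (x, f) to the continuity at x of the
  finitely many net functions.\<close>

lemma Ascoli_space_if_dense_countable_compact:
  assumes "Tychonoff_space Y" and D: "Y closure_of D = topspace Y"
    and bdd: "\<forall>A\<subseteq>D. countable A \<longrightarrow> (\<exists>C. compactin Y C \<and> A \<subseteq> C)"
  shows "Ascoli_space Y"
  unfolding Ascoli_space_def
proof (intro conjI allI impI)
  fix \<K> assume K: "compactin (C_k Y) \<K>"
  have KC: "\<K> \<subseteq> C_set Y"
    using compactin_subset_topspace[OF K] by simp
  let ?Z = "prod_topology Y (subtopology (C_k Y) \<K>)"
  have ts: "topspace ?Z = topspace Y \<times> \<K>"
    using KC by auto
  have "\<exists>U. openin ?Z U \<and> (x, f) \<in> U \<and> (\<forall>(y, g)\<in>U. \<bar>g y - f x\<bar> < e)"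
    if x: "x \<in> topspace Y" and f: "f \<in> \<K>" and "e > 0" for x f and e :: real
  proof -
    have "e/8 > 0" using \<open>e > 0\<close> by simp
    obtain N where N: "finite N" "N \<subseteq> \<K>"
        and net: "\<forall>g\<in>\<K>. \<exists>h\<in>N. \<forall>y\<in>topspace Y. \<bar>g y - h y\<bar> \<le> e/8"
      using compactin_C_k_uniform_net[OF D bdd K \<open>e/8 > 0\<close>] .
    have "compactin Y {x}" "f \<in> C_set Y"
      using x f KC by auto
    then obtain W where W: "openin (C_k Y) W" "f \<in> W" "\<forall>g\<in>W. \<forall>y\<in>{x}. \<bar>g y - f y\<bar> < e/8"
      using C_k_uniform_nbhd[OF _ _ \<open>e/8 > 0\<close>] by metis
    \<comment> \<open>V controls the variation of the net functions near x, while W controls only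
      the value at x. With h near g, the path g y, h y, h x, g x, f x has four steps of at most e/8
      each.\<close>
    define V where "V = (\<Inter>h\<in>N. {y \<in> topspace Y. h y \<in> ball (h x) (e/8)}) \<inter> topspace Y"
    have "openin Y {y \<in> topspace Y. h y \<in> ball (h x) (e/8)}" if "h \<in> N" for h
      using that N(2) KC by (intro openin_continuous_map_preimage[of _ euclideanreal]) (auto simp: C_set_def)
    then have V: "openin Y V"
      unfolding V_def by (intro openin_INT N(1))
    have "openin ?Z (V \<times> (W \<inter> \<K>))"
      using V openin_subtopology_Int[OF W(1)] unfolding openin_prod_Times_iff by blast
    moreover have "(x, f) \<in> V \<times> (W \<inter> \<K>)"
      using x f W(2) \<open>e > 0\<close> by (auto simp: V_def)
    moreover have "\<bar>g y - f x\<bar> < e" if yg: "y \<in> V" "g \<in> W \<inter> \<K>" for y g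
    proof -
      obtain h where h: "h \<in> N" "\<forall>y\<in>topspace Y. \<bar>g y - h y\<bar> \<le> e/8"
        using net yg(2) by blast
      have "y \<in> topspace Y" "\<bar>h x - h y\<bar> < e/8"
        using yg(1) h(1) by (auto simp: V_def dist_real_def)
      moreover have "\<bar>g x - f x\<bar> < e/8"
        using W(3) yg(2) by blast
      moreover have "\<bar>g y - h y\<bar> \<le> e/8" "\<bar>g x - h x\<bar> \<le> e/8"
        using h(2) x \<open>y \<in> topspace Y\<close> by blast+
      ultimately show ?thesis
        using \<open>e > 0\<close> by linarith
    qed
    ultimately show ?thesis
      by (intro exI[of _ "V \<times> (W \<inter> \<K>)"]) auto
  qed
  \<comment> \<open>The epsilon criterion is available for metric topologies; the one on the reals
    is then identified with \<open>euclideanreal\<close>.\<close>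
  then have "continuous_map ?Z Met_TC.mtopology (\<lambda>(y, f). f y)"
    unfolding Met_TC.continuous_map_to_metric ts
    by (simp add: dist_real_def abs_minus_commute split_beta)
  then show "evenly_continuous Y \<K>"
    unfolding evenly_continuous_def mtopology_is_euclidean .
qed (fact assms)

text \<open>If f were unbounded, density would give for each n a point of D with \<bar>f\<bar> > n.
  These countably many points lie in one compact set, on which f is bounded.\<close>

lemma pseudocompact_space_if_dense_countable_compact:
  assumes "Tychonoff_space Y" and D: "Y closure_of D = topspace Y"
    and bdd: "\<forall>A\<subseteq>D. countable A \<longrightarrow> (\<exists>C. compactin Y C \<and> A \<subseteq> C)"
  shows "pseudocompact_space Y"
  unfolding pseudocompact_space_def
proof (intro conjI allI impI)
  fix f assume f: "continuous_map Y euclideanreal f"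
  show "bounded (f ` topspace Y)"
  proof (rule ccontr)
    assume "\<not> bounded (f ` topspace Y)"
    then have big: "\<exists>y\<in>topspace Y. real n < \<bar>f y\<bar>" for n
      by (force simp: bounded_real not_le)
    have "\<exists>y\<in>D. real n < \<bar>f y\<bar>" for n
    proof -
      have "continuous_map Y euclideanreal (\<lambda>y. \<bar>f y\<bar>)"
        by (intro continuous_intros f)
      then have "openin Y {y \<in> topspace Y. \<bar>f y\<bar> \<in> {real n<..}}"
        by (rule openin_continuous_map_preimage) auto
      then show ?thesis
        using D big[of n] unfolding dense_intersects_open by fastforce
    qed
    then obtain p where p: "\<And>n. p n \<in> D" "\<And>n. real n < \<bar>f (p n)\<bar>"
      by metis
    obtain C where C: "compactin Y C" "range p \<subseteq> C"
      using bdd p(1) by (metis countableI_type countable_image image_subsetI)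
    have "bounded (f ` C)"
      using image_compactin[OF C(1) f] by (simp add: compact_imp_bounded)
    then obtain b where b: "\<And>y. y \<in> C \<Longrightarrow> \<bar>f y\<bar> \<le> b"
      by (auto simp: bounded_real)
    obtain n where "b < real n"
      using reals_Archimedean2 by blast
    with b[of "p n"] C(2) p(2)[of n] show False
      by auto
  qed
qed (fact assms)

section \<open>The cube and its Sigma-product\<close>

lemma Tychonoff_space_subtopology:
  "Tychonoff_space X \<Longrightarrow> Tychonoff_space (subtopology X S)"
  by (simp add: Tychonoff_space_def completely_regular_space_subtopology Hausdorff_space_subtopology)

lemma Tychonoff_space_unit_cube: "Tychonoff_space (unit_cube \<kappa>)"
  by (simp add: Tychonoff_space_def unit_cube_def completely_regular_space_product_topology
      Hausdorff_space_product_topology metrizable_imp_completely_regular_space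
      metrizable_space_subtopology metrizable_space_euclidean Hausdorff_space_subtopology)

lemma topspace_unit_cube: "topspace (unit_cube \<kappa>) = Field \<kappa> \<rightarrow>\<^sub>E {0..1}"
  by (simp add: unit_cube_def)

lemma Sigma_product_subset_topspace: "Sigma_product \<kappa> \<subseteq> topspace (unit_cube \<kappa>)"
  by (auto simp: Sigma_product_def topspace_unit_cube)

text \<open>A basic open box restricts only finitely many coordinates; setting all the others of one
  of its points to 0 stays in the box and leaves a finite support.\<close>

lemma Sigma_product_dense: "unit_cube \<kappa> closure_of Sigma_product \<kappa> = topspace (unit_cube \<kappa>)"
  unfolding dense_intersects_open
proof (intro allI impI)
  fix T :: "('a \<Rightarrow> real) set"
  assume T: "openin (unit_cube \<kappa>) T \<and> T \<noteq> {}"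
  then obtain x where x: "x \<in> T" by blast
  obtain U where fin: "finite {i \<in> Field \<kappa>. U i \<noteq> {0..1}}"
    and x: "x \<in> Pi\<^sub>E (Field \<kappa>) U" and U: "Pi\<^sub>E (Field \<kappa>) U \<subseteq> T"
    and op: "\<forall>i\<in>Field \<kappa>. openin (top_of_set {0..1}) (U i)"
    using T x unfolding unit_cube_def openin_product_topology_alt topspace_euclidean_subtopology by blast
  define z where "z = (\<lambda>i\<in>Field \<kappa>. if U i = {0..1} then 0 else x i)"
  have "z \<in> Pi\<^sub>E (Field \<kappa>) U"
    using x by (auto simp: z_def)
  moreover have "U i \<subseteq> {0..1}" if "i \<in> Field \<kappa>" for i
    using op that openin_imp_subset by blast
  moreover have "finite {i \<in> Field \<kappa>. z i \<noteq> 0}"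
    by (rule finite_subset[OF _ fin]) (auto simp: z_def)
  ultimately have "z \<in> Sigma_product \<kappa>"
    unfolding Sigma_product_def by (blast intro: countable_finite dest: PiE_mono)
  with U \<open>z \<in> Pi\<^sub>E (Field \<kappa>) U\<close> show "Sigma_product \<kappa> \<inter> T \<noteq> {}"
    by blast
qed

text \<open>The union J of the supports is countable, so the full cube over J, extended by 0
  elsewhere, is compact and contains only countably supported points.\<close>

lemma Sigma_product_countable_compact:
  assumes "countable A" "A \<subseteq> Sigma_product \<kappa>"
  obtains C where "compactin (unit_cube \<kappa>) C" "A \<subseteq> C" "C \<subseteq> Sigma_product \<kappa>"
proof
  define J where "J = (\<Union>x\<in>A. {i \<in> Field \<kappa>. x i \<noteq> 0})"
  have "countable J"
    using assms unfolding J_def by (intro countable_UN) (auto simp: Sigma_product_def)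
  let ?C = "PiE (Field \<kappa>) (\<lambda>i. if i \<in> J then {0..1::real} else {0})"
  show "compactin (unit_cube \<kappa>) ?C"
    unfolding unit_cube_def compactin_PiE by (auto simp: compactin_subtopology)
  show "A \<subseteq> ?C"
  proof
    fix x assume x: "x \<in> A"
    then have "x \<in> Field \<kappa> \<rightarrow>\<^sub>E {0..1}"
      using assms(2) by (auto simp: Sigma_product_def)
    moreover have "x i = 0" if "i \<in> Field \<kappa>" "i \<notin> J" for i
      using that x by (auto simp: J_def)
    ultimately show "x \<in> ?C"
      by (simp add: PiE_iff)
  qed
  show "?C \<subseteq> Sigma_product \<kappa>"
  proof
    fix x assume x: "x \<in> ?C"
    then have "x i = 0" if "i \<in> Field \<kappa>" "i \<notin> J" for i
      using that by (auto simp: PiE_iff dest: bspec)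
    then have "{i \<in> Field \<kappa>. x i \<noteq> 0} \<subseteq> J"
      by blast
    then have "countable {i \<in> Field \<kappa>. x i \<noteq> 0}"
      using \<open>countable J\<close> countable_subset by blast
    moreover have "x \<in> Field \<kappa> \<rightarrow>\<^sub>E {0..1}"
      using x by (auto simp: PiE_iff split: if_splits)
    ultimately show "x \<in> Sigma_product \<kappa>"
      by (simp add: Sigma_product_def)
  qed
qed

section \<open>Compact sets meeting the Sigma-product\<close>

text \<open>Stratify by size: sets of size n+1 arise by inserting one of |I| elements into a set of
  size n, and a union of at most |I| sets of size at most |I| is no larger than I.\<close>

lemma card_of_finite_subsets_ordLeq:
  assumes "infinite I"
  shows "|{F. F \<subseteq> I \<and> finite F}| \<le>o |I|"
proof -
  define P where "P n = {F. F \<subseteq> I \<and> finite F \<and> card F = n}" for n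
  have P: "|P n| \<le>o |I|" for n
  proof (induction n)
    case 0
    have "P 0 = {{}}"
      by (auto simp: P_def)
    then show ?case
      using assms by (metis card_of_singl_ordLeq finite.emptyI)
  next
    case (Suc n)
    have "P (Suc n) \<subseteq> (\<Union>i\<in>I. insert i ` P n)"
    proof
      fix F assume "F \<in> P (Suc n)"
      then obtain i G where "F = insert i G" "i \<notin> G" "finite G" "card G = n" "F \<subseteq> I"
        by (auto simp: P_def card_Suc_eq)
      then show "F \<in> (\<Union>i\<in>I. insert i ` P n)"
        by (auto simp: P_def)
    qed
    moreover have "|\<Union>i\<in>I. insert i ` P n| \<le>o |I|"
      using assms Suc card_of_image ordLeq_transitive
      by (intro card_of_UNION_ordLeq_infinite ballI card_of_refl[THEN ordIso_imp_ordLeq]) blast+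
    ultimately show ?case
      using card_of_mono1 ordLeq_transitive by blast
  qed
  have "{F. F \<subseteq> I \<and> finite F} = (\<Union>n\<in>UNIV. P n)"
    by (auto simp: P_def)
  moreover have "|UNIV :: nat set| \<le>o |I|"
    using assms infinite_iff_card_of_nat by blast
  ultimately show ?thesis
    using P assms by (auto intro: card_of_UNION_ordLeq_infinite)
qed

text \<open>The point x may have full support; z replaces it by a point of K that is still large on
  I but has small support. For each finite F in I some \<open>y F\<close> in K and the Sigma-product
  exceeds c on F, and compactness merges these finite approximations.\<close>

lemma compactin_Sigma_cluster:
  assumes K: "compactin (unit_cube \<kappa>) K"
    and x: "x \<in> unit_cube \<kappa> closure_of (K \<inter> Sigma_product \<kappa>)"
    and I: "infinite I" "I \<subseteq> Field \<kappa>" and c: "\<And>i. i \<in> I \<Longrightarrow> c < x i"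
  obtains z where "z \<in> K" "\<And>i. i \<in> I \<Longrightarrow> c \<le> z i" "|{i \<in> Field \<kappa>. z i \<noteq> 0}| \<le>o |I|"
proof -
  have proj: "continuous_map (unit_cube \<kappa>) euclideanreal (\<lambda>z. z i)" if "i \<in> Field \<kappa>" for i
    using continuous_map_product_projection[OF that, of "\<lambda>_. top_of_set {0..1::real}"]
    by (simp add: unit_cube_def continuous_map_in_subtopology)
  have "\<exists>y. y \<in> K \<inter> Sigma_product \<kappa> \<and> (\<forall>i\<in>F. c < y i)" if F: "F \<subseteq> I" "finite F" for F
  proof -
    define U where "U = (\<Inter>i\<in>F. {z \<in> topspace (unit_cube \<kappa>). z i \<in> {c<..}}) \<inter> topspace (unit_cube \<kappa>)"
    have "openin (unit_cube \<kappa>) {z \<in> topspace (unit_cube \<kappa>). z i \<in> {c<..}}" if "i \<in> F" for i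
      using that F(1) I(2) by (intro openin_continuous_map_preimage[OF proj]) auto
    then have "openin (unit_cube \<kappa>) U"
      unfolding U_def by (intro openin_INT F(2))
    moreover have "x \<in> U"
      using x c F(1) by (auto simp: U_def in_closure_of)
    ultimately obtain y where y: "y \<in> K \<inter> Sigma_product \<kappa>" "y \<in> U"
      using x unfolding in_closure_of by blast
    then have "\<forall>i\<in>F. c < y i"
      unfolding U_def by blast
    with y(1) show ?thesis
      by blast
  qed
  then obtain y where y: "\<And>F. F \<subseteq> I \<Longrightarrow> finite F \<Longrightarrow> y F \<in> K \<inter> Sigma_product \<kappa>"
      "\<And>F i. F \<subseteq> I \<Longrightarrow> finite F \<Longrightarrow> i \<in> F \<Longrightarrow> c < y F i"
    by metis
  \<comment> \<open>There are at most |I| finite subsets F, each contributing a countable support,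
    so J is no larger than I.\<close>
  define J where "J = (\<Union>F\<in>{F. F \<subseteq> I \<and> finite F}. {i \<in> Field \<kappa>. y F i \<noteq> 0})"
  have "|J| \<le>o |I|"
    unfolding J_def
  proof (intro card_of_UNION_ordLeq_infinite I ballI card_of_finite_subsets_ordLeq)
    fix F assume "F \<in> {F. F \<subseteq> I \<and> finite F}"
    then have "countable {i \<in> Field \<kappa>. y F i \<noteq> 0}"
      using y(1) by (auto simp: Sigma_product_def)
    then have "|{i \<in> Field \<kappa>. y F i \<noteq> 0}| \<le>o |UNIV :: nat set|"
      using countable_card_of_nat by blast
    then show "|{i \<in> Field \<kappa>. y F i \<noteq> 0}| \<le>o |I|"
      using I(1) infinite_iff_card_of_nat ordLeq_transitive by blast
  qed
  \<comment> \<open>The inequality is weakened to make the constraint closed, as the finite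
    intersection property requires.\<close>
  define L where "L i = {z \<in> topspace (unit_cube \<kappa>). z i \<in> {c..}}" for i
  define Z where "Z i = {z \<in> topspace (unit_cube \<kappa>). z i \<in> {0}}" for i
  define \<U> where "\<U> = L ` I \<union> Z ` (Field \<kappa> - J)"
  have "closedin (unit_cube \<kappa>) (L i)" "closedin (unit_cube \<kappa>) (Z i)" if "i \<in> Field \<kappa>" for i
    unfolding L_def Z_def using that by (intro closedin_continuous_map_preimage[OF proj]; simp)+
  then have cl: "\<forall>C\<in>\<U>. closedin (unit_cube \<kappa>) C"
    unfolding \<U>_def using I(2) by blast
  have fip: "K \<inter> \<Inter>\<F> \<noteq> {}" if F: "finite \<F>" "\<F> \<subseteq> \<U>" for \<F>
  proof -
    \<comment> \<open>Only the L-constraints depend on the choice of F: with A the finite set of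
      their indices, \<open>y A\<close> satisfies them, and it satisfies every Z-constraint because
      its support lies in J.\<close>
    have "finite (\<F> \<inter> L ` I)" "\<F> \<inter> L ` I \<subseteq> L ` I"
      using F(1) by auto
    then obtain A where A: "A \<subseteq> I" "finite A" "\<F> \<inter> L ` I = L ` A"
      by (metis finite_subset_image)
    have yA: "y A \<in> K" "y A \<in> topspace (unit_cube \<kappa>)"
      using y(1)[OF A(1,2)] Sigma_product_subset_topspace by auto
    have "y A \<in> L i" if "i \<in> A" for i
      using y(2)[OF A(1,2) that] yA(2) by (simp add: L_def)
    moreover have "y A \<in> Z i" if "i \<in> Field \<kappa> - J" for i
      using that A(1,2) yA(2) by (auto simp: J_def Z_def)
    ultimately have "y A \<in> C" if "C \<in> \<F>" for C
      using that F(2) A(3) unfolding \<U>_def by blast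
    with yA(1) show ?thesis
      by blast
  qed
  have "K \<inter> \<Inter>\<U> \<noteq> {}"
    using compactin_fip[THEN iffD1, OF K, THEN conjunct2, THEN spec, of \<U>] cl fip by blast
  then obtain z where z: "z \<in> K" "z \<in> \<Inter>\<U>"
    by blast
  show thesis
  proof
    show "z \<in> K" by fact
    show "c \<le> z i" if "i \<in> I" for i
    proof -
      have "L i \<in> \<U>"
        using that by (simp add: \<U>_def)
      then have "z \<in> L i"
        using z(2) by blast
      then show ?thesis
        by (simp add: L_def)
    qed
    have "z i = 0" if "i \<in> Field \<kappa> - J" for i
    proof -
      have "Z i \<in> \<U>"
        using that by (simp add: \<U>_def)
      then have "z \<in> Z i"
        using z(2) by blast
      then show ?thesis
        by (simp add: Z_def)
    qed
    then have "{i \<in> Field \<kappa>. z i \<noteq> 0} \<subseteq> J"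
      by blast
    then show "|{i \<in> Field \<kappa>. z i \<noteq> 0}| \<le>o |I|"
      using \<open>|J| \<le>o |I|\<close> card_of_mono1 ordLeq_transitive by blast
  qed
qed

text \<open>K is closed, so a missing limit of \<open>K \<inter> Sigma_product \<kappa>\<close>
  would lie in X. The point z from \<open>compactin_Sigma_cluster\<close> then fits nowhere: I is
  uncountable, so z is outside the Sigma-product, and |I| < |\<open>Field \<kappa>\<close>| excludes
  X, whose points have full support.\<close>

lemma compactin_Sigma_product_Int:
  fixes \<kappa> :: "'i rel"
  assumes \<kappa>: "Card_order \<kappa>" "cardSuc natLeq <o \<kappa>"
    and X: "\<And>x i. x \<in> X \<Longrightarrow> i \<in> Field \<kappa> \<Longrightarrow> c < x i" and "c > 0"
    and K: "compactin (unit_cube \<kappa>) K" "K \<subseteq> Sigma_product \<kappa> \<union> X"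
  shows "compactin (unit_cube \<kappa>) (K \<inter> Sigma_product \<kappa>)"
proof -
  \<comment> \<open>A copy of \<open>\<omega>\<^sub>1\<close> living on a proper subset of
    \<open>Field \<kappa>\<close>; its field is the index set I.\<close>
  obtain p :: "'i rel" where p: "Field p < Field \<kappa>" "cardSuc natLeq =o p" "p <o \<kappa>"
    using iffD1[OF internalize_ordLess \<kappa>(2)] by blast
  define I where "I = Field p"
  have "Card_order p"
    using p(2) natLeq_Card_order cardSuc_Card_order Card_order_ordIso2 by blast
  then have Ip: "|I| =o p"
    unfolding I_def by (rule card_of_Field_ordIso)
  have "natLeq <o p"
    using cardSuc_greater[OF natLeq_Card_order] p(2) by (rule ordLess_ordIso_trans)
  then have nI: "natLeq <o |I|"
    using Ip ordIso_symmetric ordLess_ordIso_trans by blast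
  have I\<kappa>: "|I| <o |Field \<kappa>|"
    using Ip p(3) card_of_Field_ordIso[OF \<kappa>(1)] ordIso_symmetric ordIso_ordLess_trans ordLess_ordIso_trans
    by blast
  have "uncountable I"
    using nI unfolding countable_card_le_natLeq by (metis not_ordLess_ordLeq)
  then have "infinite I" "I \<subseteq> Field \<kappa>"
    using p(1) uncountable_infinite by (auto simp: I_def)
  let ?S = "Sigma_product \<kappa>" and ?Q = "unit_cube \<kappa>"
  have Kcl: "closedin ?Q K"
    using compactin_imp_closedin[OF _ K(1)] Tychonoff_space_unit_cube by (auto simp: Tychonoff_space_def)
  have "x \<in> ?S" if x: "x \<in> ?Q closure_of (K \<inter> ?S)" for x
  proof (rule ccontr)
    assume "x \<notin> ?S"
    moreover have "x \<in> K"
      using x Kcl closure_of_minimal[of "K \<inter> ?S" K ?Q] by blast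
    ultimately have "x \<in> X"
      using K(2) by blast
    then obtain z where z: "z \<in> K" "\<And>i. i \<in> I \<Longrightarrow> c \<le> z i" and supp: "|{i \<in> Field \<kappa>. z i \<noteq> 0}| \<le>o |I|"
      using compactin_Sigma_cluster[OF K(1) x \<open>infinite I\<close> \<open>I \<subseteq> Field \<kappa>\<close>, of c] X \<open>I \<subseteq> Field \<kappa>\<close> by blast
    have "I \<subseteq> {i \<in> Field \<kappa>. z i \<noteq> 0}"
      using z(2) \<open>c > 0\<close> \<open>I \<subseteq> Field \<kappa>\<close> by force
    then have "z \<notin> ?S"
      using \<open>uncountable I\<close> countable_subset unfolding Sigma_product_def by blast
    then have "z \<in> X"
      using z(1) K(2) by blast
    then have "{i \<in> Field \<kappa>. z i \<noteq> 0} = Field \<kappa>"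
      using X \<open>c > 0\<close> by force
    then show False
      using supp I\<kappa> not_ordLess_ordLeq by metis
  qed
  then have "?Q closure_of (K \<inter> ?S) \<subseteq> K \<inter> ?S"
    using Kcl closure_of_minimal[of "K \<inter> ?S" K ?Q] by blast
  then have "closedin ?Q (K \<inter> ?S)"
    using compactin_subset_topspace[OF K(1)] closure_of_subset_eq[of "K \<inter> ?S" ?Q] by blast
  then show ?thesis
    using closed_compactin[OF K(1)] by blast
qed

section \<open>The space formed by the Sigma-product and X\<close>

theorem proposition3p11:
  fixes \<kappa> :: "'i rel"
    and X S :: "('i \<Rightarrow> real) set"
    and Y :: "('i \<Rightarrow> real) topology"
  assumes "Card_order \<kappa>"
    and "cardSuc natLeq <o \<kappa>"
    and "X \<subseteq> (Field \<kappa> \<rightarrow>\<^sub>E {1/2..1})"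
    and "S = Sigma_product \<kappa>"
    and "Y = subtopology (unit_cube \<kappa>) (S \<union> X)"
  shows "(pseudocompact_space Y \<and> Ascoli_space Y)
    \<and> (\<forall>K. compactin Y K \<longrightarrow> compactin Y (K \<inter> S) \<and> compactin Y (K \<inter> X))
    \<and> (X \<noteq> {} \<longrightarrow> \<not> k_R_space Y)
    \<and> closedin Y X"
proof -
  note \<kappa> = assms(1,2) and S_def = assms(4) and Y_def = assms(5)
  have X: "1/2 \<le> x i" if "x \<in> X" "i \<in> Field \<kappa>" for x i
    using assms(3) that by (auto simp: PiE_iff)
  have "X \<subseteq> topspace (unit_cube \<kappa>)"
    unfolding topspace_unit_cube
    by (rule subset_trans[OF assms(3) PiE_mono]) auto
  then have Q: "S \<union> X \<subseteq> topspace (unit_cube \<kappa>)"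
    using Sigma_product_subset_topspace S_def by blast
  then have topY: "topspace Y = S \<union> X"
    unfolding Y_def topspace_subtopology by blast
  have T: "Tychonoff_space Y"
    unfolding Y_def by (intro Tychonoff_space_subtopology Tychonoff_space_unit_cube)
  have compY: "compactin Y C \<longleftrightarrow> compactin (unit_cube \<kappa>) C \<and> C \<subseteq> S \<union> X" for C
    unfolding Y_def by (rule compactin_subtopology)
  have dense: "Y closure_of S = topspace Y"
    unfolding Y_def closure_of_subtopology topspace_subtopology
    using Sigma_product_dense[of \<kappa>] by (simp add: S_def Int_commute Int_absorb1)
  have bdd: "\<forall>A\<subseteq>S. countable A \<longrightarrow> (\<exists>C. compactin Y C \<and> A \<subseteq> C)"
    using Sigma_product_countable_compact compY unfolding S_def by (metis le_supI1)
  have "natLeq <o \<kappa>"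
    using \<kappa>(2) cardSuc_greater[OF natLeq_Card_order] ordLess_transitive by blast
  then have "natLeq <o |Field \<kappa>|"
    using card_of_Field_ordIso[OF \<kappa>(1)] ordIso_symmetric ordLess_ordIso_trans by blast
  then have unc: "uncountable (Field \<kappa>)"
    unfolding countable_card_le_natLeq using not_ordLess_ordLeq by blast
  \<comment> \<open>Disjointness is proved for the whole closed cube over [1/2, 1], so that X is the
    trace of this cube on Y and hence closed in Y.\<close>
  have half: "(Field \<kappa> \<rightarrow>\<^sub>E {1/2..1}) \<inter> S = {}"
  proof -
    have False if x: "x \<in> S" "x \<in> Field \<kappa> \<rightarrow>\<^sub>E {1/2..1}" for x
    proof -
      have "{i \<in> Field \<kappa>. x i \<noteq> 0} = Field \<kappa>"
        using x(2) by force
      then show False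
        using x(1) unc by (simp add: S_def Sigma_product_def)
    qed
    then show ?thesis by blast
  qed
  have disj: "S \<inter> X = {}"
    using half assms(3) by blast
  have "closedin (unit_cube \<kappa>) (Field \<kappa> \<rightarrow>\<^sub>E {1/2..1})"
    unfolding unit_cube_def closedin_product_topology by (auto intro: closed_subset)
  then have clX: "closedin Y X"
    unfolding Y_def closedin_subtopology using assms(3) half by blast
  have comp: "compactin Y (K \<inter> S)" "compactin Y (K \<inter> X)" if K: "compactin Y K" for K
  proof -
    have K': "compactin (unit_cube \<kappa>) K" "K \<subseteq> Sigma_product \<kappa> \<union> X"
      using K unfolding compY S_def by blast+
    \<comment> \<open>Coordinates in X may equal 1/2, while the lemma on compact sets asks for a
      strict positive lower bound; 1/4 provides one.\<close>
    have X': "1/4 < x i" if "x \<in> X" "i \<in> Field \<kappa>" for x i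
      using X[OF that] by linarith
    have "compactin (unit_cube \<kappa>) (K \<inter> Sigma_product \<kappa>)"
      by (rule compactin_Sigma_product_Int[OF \<kappa>, where c = "1/4" and X = X])
        (erule (1) X', simp, rule K', rule K')
    then show "compactin Y (K \<inter> S)"
      unfolding compY S_def by blast
    show "compactin Y (K \<inter> X)"
      using K clX by (rule compact_Int_closedin)
  qed
  have "\<not> k_R_space Y" if "X \<noteq> {}"
  proof
    assume kR: "k_R_space Y"
    let ?f = "indicat_real X"
    have "k_continuous Y ?f"
      unfolding k_continuous_def
    proof (intro allI impI)
      fix K assume K: "compactin Y K"
      have H: "Hausdorff_space Y"
        using T by (simp add: Tychonoff_space_def)
      \<comment> \<open>K is the disjoint union of these two closed sets, so the indicator, constant
        on each, is continuous on K.\<close>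
      have cl: "closedin (subtopology Y K) (K \<inter> S)" "closedin (subtopology Y K) (K \<inter> X)"
        using comp[OF K] H
        by (auto intro!: compactin_imp_closedin Hausdorff_space_subtopology
            simp: compactin_subtopology)
      show "continuous_map (subtopology Y K) euclideanreal ?f"
        unfolding continuous_map_closedin
      proof (intro conjI ballI allI impI)
        show "?f \<in> topspace (subtopology Y K) \<rightarrow> topspace euclideanreal"
          by simp
        fix C :: "real set"
        have "K \<subseteq> S \<union> X"
          using K compY by blast
        then have "{x \<in> topspace (subtopology Y K). ?f x \<in> C} =
            (if 0 \<in> C then K \<inter> S else {}) \<union> (if 1 \<in> C then K \<inter> X else {})"
          using disj topY by (auto simp: indicator_def split: if_splits)
        then show "closedin (subtopology Y K) {x \<in> topspace (subtopology Y K). ?f x \<in> C}"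
          using cl by auto
      qed
    qed
    then have "continuous_map Y euclideanreal ?f"
      using kR by (simp add: k_R_space_def)
    then have "openin Y {x \<in> topspace Y. ?f x \<in> {0<..}}"
      by (rule openin_continuous_map_preimage) auto
    moreover have "{x \<in> topspace Y. ?f x \<in> {0<..}} = X"
      using topY by (auto simp: indicator_def split: if_splits)
    \<comment> \<open>X would be a nonempty open set missing the dense S.\<close>
    ultimately show False
      using dense that disj unfolding dense_intersects_open by auto
  qed
  then show ?thesis
    using comp clX pseudocompact_space_if_dense_countable_compact[OF T dense bdd]
      Ascoli_space_if_dense_countable_compact[OF T dense bdd] by blast
qed

end
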